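(* Let $A$ be a chromotopology and $v$ a vertex of $A$. Then the poset $P_v(A)$ is isomorphic to $J(E_v(A))$, the poset of order ideals of $E_v(A)$ ordered by inclusion. Consequently $P_v(A)$ is a finite distributive lattice.
   Context: A chromotopology of dimension $n$ is a finite connected simple bipartite graph in which every vertex has degree $n$, whose edges are colored by $[n]$ so that each vertex is incident to exactly one edge of each color, and such that for any distinct colors $i,j$ the edges of colors $i,j$ form a disjoint union of $4$-cycles. A ranking of $A$ is a function $h\colon V(A)\to\mathbf{Z}$ with $|h(u)-h(w)|=1$ for every edge $\{u,w\}$, considered up to adding a constant; $R(A)$ is the set of rankings. A vertex $w$ is a source (resp. sink) of $h$ if all its neighbors have larger (resp. smaller) $h$-value. Vertex raising at a source $w$ replaces $h$ by $h+2\cdot\mathbf{1}_w$; vertex lowering at a sink $w$ replaces $h$ by $h-2\cdot\mathbf{1}_w$. $P_v(A)$ is the poset on $R(A)$ in which $B\le C$ iff $C$ is obtained from $B$ by a (possibly empty) sequence of vertex raisings at vertices other than $v$. $D(u,w)$ denotes graph distance in $A$. The $v$-elevation poset $E_v(A)$ has elements the pairs $(w,t)$ with $w\in V(A)$, $w\neq v$, $t\in\{1,2,\dots,D(w,v)\}$, and its order is generated by the following covering relations: whenever $w_1,w_2$ are adjacent with $D(w_1,v)+1=D(w_2,v)$, $(w_1,t)$ covers $(w_2,t)$ and $(w_2,t+1)$ covers $(w_1,t)$ (whenever these elements exist). An order ideal of a poset is a subset $S$ such that $s\in S$ and $s>t$ imply $t\in S$. *)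

theory Defs
  imports "HOL-Algebra.Lattice"
begin

section \<open>Chromotopologies\<close>

text \<open>Graphs are simple and undirected: an edge is a two-element set of vertices.  The function
  \<open>color\<close> is only relevant on edges.\<close>

record 'a colored_graph =
  verts :: "'a set"
  edges :: "'a set set"
  color :: "'a set \<Rightarrow> nat"

definition simple_graph :: "'a colored_graph \<Rightarrow> bool" where
  "simple_graph A \<longleftrightarrow> (\<forall>e\<in>edges A. \<exists>u\<in>verts A. \<exists>w\<in>verts A. u \<noteq> w \<and> e = {u, w})"

definition adj :: "'a colored_graph \<Rightarrow> ('a \<times> 'a) set" where
  "adj A = {(u, w). {u, w} \<in> edges A}"

definition connected_graph :: "'a colored_graph \<Rightarrow> bool" where
  "connected_graph A \<longleftrightarrow> verts A \<noteq> {} \<and> (\<forall>u\<in>verts A. \<forall>w\<in>verts A. (u, w) \<in> (adj A)\<^sup>*)"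

definition bipartite :: "'a colored_graph \<Rightarrow> bool" where
  "bipartite A \<longleftrightarrow> (\<exists>X Y. X \<union> Y = verts A \<and> X \<inter> Y = {} \<and>
     (\<forall>e\<in>edges A. \<exists>x\<in>X. \<exists>y\<in>Y. e = {x, y}))"

definition graph_dist :: "'a colored_graph \<Rightarrow> 'a \<Rightarrow> 'a \<Rightarrow> nat" where
  "graph_dist A u w = (LEAST k. (u, w) \<in> adj A ^^ k)"

definition four_cycle :: "'a set set \<Rightarrow> bool" where
  "four_cycle F \<longleftrightarrow> (\<exists>a b c d. distinct [a, b, c, d] \<and> F = {{a, b}, {b, c}, {c, d}, {d, a}})"

text \<open>An edge set \<open>F\<close> has vertex set \<open>\<Union>F\<close>, so the following says that the cycles are
  pairwise vertex-disjoint.\<close>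

definition disjoint_union_of_four_cycles :: "'a set set \<Rightarrow> bool" where
  "disjoint_union_of_four_cycles S \<longleftrightarrow>
     (\<exists>C. (\<forall>F\<in>C. four_cycle F) \<and> pairwise (\<lambda>F G. disjnt (\<Union>F) (\<Union>G)) C \<and> \<Union>C = S)"

definition chromotopology :: "nat \<Rightarrow> 'a colored_graph \<Rightarrow> bool" where
  "chromotopology n A \<longleftrightarrow>
     finite (verts A) \<and> connected_graph A \<and> simple_graph A \<and> bipartite A \<and>
     (\<forall>u\<in>verts A. card {e \<in> edges A. u \<in> e} = n) \<and>
     color A ` edges A \<subseteq> {1..n} \<and>
     (\<forall>u\<in>verts A. \<forall>i\<in>{1..n}. \<exists>!e. e \<in> edges A \<and> u \<in> e \<and> color A e = i) \<and>
     (\<forall>i\<in>{1..n}. \<forall>j\<in>{1..n}. i \<noteq> j \<longrightarrow>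
        disjoint_union_of_four_cycles {e \<in> edges A. color A e \<in> {i, j}})"


section \<open>Rankings and vertex raising\<close>

text \<open>Rankings are extensional, so that they are really functions on the vertex set.\<close>

definition rankings :: "'a colored_graph \<Rightarrow> ('a \<Rightarrow> int) set" where
  "rankings A = {h \<in> verts A \<rightarrow>\<^sub>E UNIV. \<forall>(u, w) \<in> adj A. \<bar>h u - h w\<bar> = 1}"

definition shift_rel :: "'a colored_graph \<Rightarrow> (('a \<Rightarrow> int) \<times> ('a \<Rightarrow> int)) set" where
  "shift_rel A = {(h, g). h \<in> rankings A \<and> g \<in> rankings A \<and> (\<exists>c. \<forall>u\<in>verts A. g u = h u + c)}"

definition ranking_classes :: "'a colored_graph \<Rightarrow> ('a \<Rightarrow> int) set set" where
  "ranking_classes A = rankings A // shift_rel A"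

definition is_source :: "'a colored_graph \<Rightarrow> ('a \<Rightarrow> int) \<Rightarrow> 'a \<Rightarrow> bool" where
  "is_source A h w \<longleftrightarrow> (\<forall>u. (w, u) \<in> adj A \<longrightarrow> h w < h u)"

definition raise :: "'a \<Rightarrow> ('a \<Rightarrow> int) \<Rightarrow> 'a \<Rightarrow> int" where
  "raise w h = h(w := h w + 2)"

definition raising_step :: "'a colored_graph \<Rightarrow> 'a \<Rightarrow> (('a \<Rightarrow> int) set \<times> ('a \<Rightarrow> int) set) set" where
  "raising_step A v = {(B, C). B \<in> ranking_classes A \<and>
     (\<exists>h\<in>B. \<exists>w\<in>verts A. w \<noteq> v \<and> is_source A h w \<and> C = shift_rel A `` {raise w h})}"

definition ranking_poset :: "'a colored_graph \<Rightarrow> 'a \<Rightarrow> ('a \<Rightarrow> int) set gorder" where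
  "ranking_poset A v =
     \<lparr> carrier = ranking_classes A, eq = (=), le = (\<lambda>B C. (B, C) \<in> (raising_step A v)\<^sup>*) \<rparr>"


section \<open>The elevation poset and order ideals\<close>

definition elevation_elems :: "'a colored_graph \<Rightarrow> 'a \<Rightarrow> ('a \<times> nat) set" where
  "elevation_elems A v = {(w, t). w \<in> verts A \<and> w \<noteq> v \<and> t \<in> {1..graph_dist A w v}}"

text \<open>A pair \<open>(x, y)\<close> in the following relation means that \<open>y\<close> covers \<open>x\<close>.\<close>

definition elevation_covers :: "'a colored_graph \<Rightarrow> 'a \<Rightarrow> (('a \<times> nat) \<times> ('a \<times> nat)) set" where
  "elevation_covers A v =
     ({((w\<^sub>2, t), (w\<^sub>1, t)) | w\<^sub>1 w\<^sub>2 t.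
         (w\<^sub>1, w\<^sub>2) \<in> adj A \<and> graph_dist A w\<^sub>1 v + 1 = graph_dist A w\<^sub>2 v} \<union>
      {((w\<^sub>1, t), (w\<^sub>2, t + 1)) | w\<^sub>1 w\<^sub>2 t.
         (w\<^sub>1, w\<^sub>2) \<in> adj A \<and> graph_dist A w\<^sub>1 v + 1 = graph_dist A w\<^sub>2 v})
     \<inter> elevation_elems A v \<times> elevation_elems A v"

definition elevation_poset :: "'a colored_graph \<Rightarrow> 'a \<Rightarrow> ('a \<times> nat) gorder" where
  "elevation_poset A v =
     \<lparr> carrier = elevation_elems A v, eq = (=), le = (\<lambda>x y. (x, y) \<in> (elevation_covers A v)\<^sup>*) \<rparr>"

definition order_ideal :: "('b, 'c) gorder_scheme \<Rightarrow> 'b set \<Rightarrow> bool" where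
  "order_ideal L S \<longleftrightarrow>
     S \<subseteq> carrier L \<and> (\<forall>s\<in>S. \<forall>t\<in>carrier L. t \<sqsubset>\<^bsub>L\<^esub> s \<longrightarrow> t \<in> S)"

definition ideal_poset :: "('b, 'c) gorder_scheme \<Rightarrow> 'b set gorder" where
  "ideal_poset L = \<lparr> carrier = {S. order_ideal L S}, eq = (=), le = (\<subseteq>) \<rparr>"


section \<open>Isomorphic posets and distributive lattices\<close>

definition poset_isomorphic :: "('b, 'd) gorder_scheme \<Rightarrow> ('c, 'e) gorder_scheme \<Rightarrow> bool" where
  "poset_isomorphic L M \<longleftrightarrow> partial_order L \<and> partial_order M \<and>
     (\<exists>f. bij_betw f (carrier L) (carrier M) \<and> order_emb L M f)"

definition distributive_lattice :: "('b, 'c) gorder_scheme \<Rightarrow> bool" where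
  "distributive_lattice L \<longleftrightarrow> Lattice.lattice L \<and>
     (\<forall>x\<in>carrier L. \<forall>y\<in>carrier L. \<forall>z\<in>carrier L.
        x \<sqinter>\<^bsub>L\<^esub> (y \<squnion>\<^bsub>L\<^esub> z) = (x \<sqinter>\<^bsub>L\<^esub> y) \<squnion>\<^bsub>L\<^esub> (x \<sqinter>\<^bsub>L\<^esub> z))"


section \<open>Well-definedness\<close>

lemma equiv_shift_rel: "equiv (rankings A) (shift_rel A)"
proof (rule equivI)
  show "refl_on (rankings A) (shift_rel A)"
    unfolding refl_on_def shift_rel_def by (auto intro: exI[of _ 0])
  show "shift_rel A \<subseteq> rankings A \<times> rankings A"
    unfolding shift_rel_def by auto
  show "sym (shift_rel A)"
  proof (rule symI)
    fix h g assume "(h, g) \<in> shift_rel A"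
    then obtain c where c: "\<forall>u\<in>verts A. g u = h u + c" "h \<in> rankings A" "g \<in> rankings A"
      unfolding shift_rel_def by auto
    then have "\<forall>u\<in>verts A. h u = g u + (- c)" by auto
    with c show "(g, h) \<in> shift_rel A" unfolding shift_rel_def by blast
  qed
  show "trans (shift_rel A)"
  proof (rule transI)
    fix h g k assume "(h, g) \<in> shift_rel A" "(g, k) \<in> shift_rel A"
    then obtain c d where c: "\<forall>u\<in>verts A. g u = h u + c" "\<forall>u\<in>verts A. k u = g u + d"
      "h \<in> rankings A" "k \<in> rankings A"
      unfolding shift_rel_def by blast
    then have "\<forall>u\<in>verts A. k u = h u + (c + d)" by auto
    with c show "(h, k) \<in> shift_rel A" unfolding shift_rel_def by blast
  qed
qed

lemma adj_verts:
  assumes "simple_graph A" "(u, w) \<in> adj A"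
  shows "u \<in> verts A" "w \<in> verts A" "u \<noteq> w" "(w, u) \<in> adj A"
proof -
  obtain a b where ab: "a \<in> verts A" "b \<in> verts A" "a \<noteq> b" "{u, w} = {a, b}"
    using assms unfolding simple_graph_def adj_def by blast
  then have "(u = a \<and> w = b) \<or> (u = b \<and> w = a)"
    by (simp add: doubleton_eq_iff)
  then show "u \<in> verts A" "w \<in> verts A" "u \<noteq> w" using ab by auto
  show "(w, u) \<in> adj A" using assms(2) unfolding adj_def by (simp add: insert_commute)
qed

lemma raise_rankings:
  assumes A: "simple_graph A" and h: "h \<in> rankings A" and w: "w \<in> verts A" "is_source A h w"
  shows "raise w h \<in> rankings A"
proof -
  have "\<bar>raise w h x - raise w h y\<bar> = 1" if xy: "(x, y) \<in> adj A" for x y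
  proof -
    have *: "\<bar>h x - h y\<bar> = 1" using h xy unfolding rankings_def by auto
    have "x \<noteq> y" and yx: "(y, x) \<in> adj A" using adj_verts[OF A xy] by auto
    moreover have "x = w \<Longrightarrow> h x < h y" "y = w \<Longrightarrow> h y < h x"
      using w xy yx unfolding is_source_def by auto
    ultimately show ?thesis using * unfolding raise_def by auto
  qed
  moreover have "raise w h \<in> verts A \<rightarrow>\<^sub>E UNIV"
    using h w unfolding rankings_def raise_def by (auto simp: PiE_def extensional_def)
  ultimately show ?thesis unfolding rankings_def by auto
qed

text \<open>Sources and raisings do not depend on the chosen representative.\<close>

lemma raise_cong:
  assumes A: "simple_graph A" and hg: "(h, g) \<in> shift_rel A"
    and w: "w \<in> verts A" "is_source A h w"
  shows "is_source A g w" "(raise w h, raise w g) \<in> shift_rel A"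
proof -
  obtain c where c: "\<forall>u\<in>verts A. g u = h u + c" "h \<in> rankings A" "g \<in> rankings A"
    using hg unfolding shift_rel_def by auto
  show s: "is_source A g w"
    unfolding is_source_def
  proof (intro allI impI)
    fix u assume wu: "(w, u) \<in> adj A"
    then have "h w < h u" using w(2) unfolding is_source_def by blast
    then show "g w < g u" using c(1) w(1) adj_verts(2)[OF A wu] by simp
  qed
  have "\<forall>u\<in>verts A. raise w g u = raise w h u + c"
    using c w unfolding raise_def by auto
  then show "(raise w h, raise w g) \<in> shift_rel A"
    using raise_rankings[OF A c(2) w] raise_rankings[OF A c(3) w(1) s]
    unfolding shift_rel_def by blast
qed

lemma partial_order_elevation_poset: "partial_order (elevation_poset A v)"
proof -
  define r :: "'a \<times> nat \<Rightarrow> int" where "r = (\<lambda>(w, t). 2 * int t - int (graph_dist A w v))"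
  have step: "r y = r x + 1" if "(x, y) \<in> elevation_covers A v" for x y
    using that unfolding elevation_covers_def r_def by auto
  have mono: "x = y \<or> r x < r y" if "(x, y) \<in> (elevation_covers A v)\<^sup>*" for x y
    using that by (induction rule: rtrancl_induct) (auto dest: step)
  show ?thesis
    unfolding elevation_poset_def
    by unfold_locales (auto dest!: mono intro: rtrancl_trans)
qed

end

(* Normalise a ranking h by h(v) = 0. Then h(w) lies between -D(w,v) and D(w,v) and has the parity
   of D(w,v), so h(w) = -D(w,v) + 2k with 0 <= k <= D(w,v). Marking the elements (w,1), ..., (w,k)
   turns rankings into order ideals: the two kinds of covering relations say exactly that h changes
   by one along each edge. Inclusion of ideals is the pointwise order of normalised rankings, and
   this is generated by raisings: if h <= g and h is not g, then a vertex of minimal h-value among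
   those with h < g is a source of h. *)

theory Submission
  imports Defs
begin

section \<open>Lattices of sets\<close>

text \<open>A family closed under union and intersection contains the images of the candidate joins
  and meets. Pulled back along \<open>f\<close> they are least upper and greatest lower bounds, and
  injectivity of \<open>f\<close> transfers the distributive law from sets.\<close>

lemma distributive_lattice_if_ring_of_sets:
  assumes "partial_order L"
    and bij: "bij_betw f (carrier L) F"
    and le: "\<And>x y. x \<in> carrier L \<Longrightarrow> y \<in> carrier L \<Longrightarrow> x \<sqsubseteq>\<^bsub>L\<^esub> y \<longleftrightarrow> f x \<subseteq> f y"
    and Un: "\<And>S T. S \<in> F \<Longrightarrow> T \<in> F \<Longrightarrow> S \<union> T \<in> F"
    and Int: "\<And>S T. S \<in> F \<Longrightarrow> T \<in> F \<Longrightarrow> S \<inter> T \<in> F"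
  shows "distributive_lattice L"
proof -
  interpret partial_order L by fact
  have inF: "f x \<in> F" if "x \<in> carrier L" for x
    using bij that by (auto simp: bij_betw_def)
  have surj: "\<exists>z\<in>carrier L. f z = S" if "S \<in> F" for S
    using bij that by (auto simp: bij_betw_def)
  have inj: "x = y" if "f x = f y" "x \<in> carrier L" "y \<in> carrier L" for x y
    using bij that by (auto simp: bij_betw_def inj_on_def)
  have sup: "least L z (Upper L {x, y})"
    if "x \<in> carrier L" "y \<in> carrier L" "z \<in> carrier L" "f z = f x \<union> f y" for x y z
  proof (rule least_UpperI)
    fix u assume "u \<in> Upper L {x, y}"
    then have "u \<in> carrier L" "x \<sqsubseteq>\<^bsub>L\<^esub> u" "y \<sqsubseteq>\<^bsub>L\<^esub> u" using that by auto
    then show "z \<sqsubseteq>\<^bsub>L\<^esub> u" using that by (simp add: le)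
  qed (use that le in auto)
  have inf: "greatest L z (Lower L {x, y})"
    if "x \<in> carrier L" "y \<in> carrier L" "z \<in> carrier L" "f z = f x \<inter> f y" for x y z
  proof (rule greatest_LowerI)
    fix u assume "u \<in> Lower L {x, y}"
    then have "u \<in> carrier L" "u \<sqsubseteq>\<^bsub>L\<^esub> x" "u \<sqsubseteq>\<^bsub>L\<^esub> y" using that by auto
    then show "u \<sqsubseteq>\<^bsub>L\<^esub> z" using that by (simp add: le)
  qed (use that le in auto)
  interpret lattice: Lattice.lattice L
  proof unfold_locales
    fix x y assume xy: "x \<in> carrier L" "y \<in> carrier L"
    show "\<exists>s. least L s (Upper L {x, y})"
      using surj[OF Un[OF inF inF, OF xy]] sup xy by blast
    show "\<exists>s. greatest L s (Lower L {x, y})"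
      using surj[OF Int[OF inF inF, OF xy]] inf xy by blast
  qed
  have join: "f (x \<squnion>\<^bsub>L\<^esub> y) = f x \<union> f y" if xy: "x \<in> carrier L" "y \<in> carrier L" for x y
  proof -
    obtain z where z: "z \<in> carrier L" "f z = f x \<union> f y"
      using surj[OF Un[OF inF inF, OF xy]] by blast
    have "x \<squnion>\<^bsub>L\<^esub> y = z"
      by (rule lattice.joinI[OF _ xy]) (rule least_unique[OF _ sup[OF xy z]])
    then show ?thesis using z by simp
  qed
  have meet: "f (x \<sqinter>\<^bsub>L\<^esub> y) = f x \<inter> f y" if xy: "x \<in> carrier L" "y \<in> carrier L" for x y
  proof -
    obtain z where z: "z \<in> carrier L" "f z = f x \<inter> f y"
      using surj[OF Int[OF inF inF, OF xy]] by blast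
    have "x \<sqinter>\<^bsub>L\<^esub> y = z"
      by (rule lattice.meetI[OF _ xy]) (rule greatest_unique[OF _ inf[OF xy z]])
    then show ?thesis using z by simp
  qed
  show ?thesis
    unfolding distributive_lattice_def
  proof (intro conjI ballI)
    show "Lattice.lattice L" by unfold_locales
    fix x y z assume xyz: "x \<in> carrier L" "y \<in> carrier L" "z \<in> carrier L"
    show "x \<sqinter>\<^bsub>L\<^esub> (y \<squnion>\<^bsub>L\<^esub> z) = (x \<sqinter>\<^bsub>L\<^esub> y) \<squnion>\<^bsub>L\<^esub> (x \<sqinter>\<^bsub>L\<^esub> z)"
      using xyz by (intro inj) (auto simp: join meet)
  qed
qed

section \<open>Order ideals under union and intersection\<close>

lemma order_ideal_Un: "order_ideal L S \<Longrightarrow> order_ideal L T \<Longrightarrow> order_ideal L (S \<union> T)"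
  unfolding order_ideal_def by blast

lemma order_ideal_Int: "order_ideal L S \<Longrightarrow> order_ideal L T \<Longrightarrow> order_ideal L (S \<inter> T)"
  unfolding order_ideal_def by blast

lemma partial_order_ideal_poset: "partial_order (ideal_poset L)"
  unfolding ideal_poset_def by unfold_locales auto

text \<open>Used for the columns of an ideal: a column is then determined by its height. The bound
  \<open>m\<close> makes \<open>T\<close> finite, so that one can descend from \<open>Max T\<close>
  one level at a time.\<close>

lemma initial_segment_eq_atLeastAtMost:
  fixes T :: "nat set"
  assumes "T \<subseteq> {1..m}" and down: "\<And>t. 1 \<le> t \<Longrightarrow> Suc t \<in> T \<Longrightarrow> t \<in> T"
  shows "T = {1..card T}"
proof (cases "T = {}")
  case False
  have fin: "finite T" using assms(1) finite_subset by blast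
  have "t \<in> T" if "t \<le> Max T" "1 \<le> t" for t
    using that(1,2)
  proof (induction rule: inc_induct)
    case base
    show ?case using Max_in[OF fin False] .
  next
    case (step t)
    then show ?case using down[of t] by simp
  qed
  then have "T = {1..Max T}"
    using assms(1) fin by auto
  then show ?thesis by (metis card_atLeastAtMost diff_Suc_1)
qed simp


section \<open>Graph distance\<close>

lemma relpow_graph_dist:
  assumes "(u, w) \<in> (adj A)\<^sup>*"
  shows "(u, w) \<in> adj A ^^ graph_dist A u w"
  using assms unfolding graph_dist_def by (metis LeastI_ex rtrancl_power)

lemma graph_dist_le: "(u, w) \<in> adj A ^^ k \<Longrightarrow> graph_dist A u w \<le> k"
  unfolding graph_dist_def by (rule Least_le)

section \<open>Rankings along walks\<close>

lemma rankings_adj: "h \<in> rankings A \<Longrightarrow> (u, w) \<in> adj A \<Longrightarrow> \<bar>h u - h w\<bar> = 1"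
  unfolding rankings_def by auto

text \<open>Each edge changes the ranking by plus or minus one, so \<open>k\<close> edges change it
  by at most \<open>k\<close>, and by a number of the parity of \<open>k\<close>.\<close>

lemma rankings_relpow:
  assumes "h \<in> rankings A" "(u, w) \<in> adj A ^^ k"
  shows "\<bar>h u - h w\<bar> \<le> int k" "even (h u - h w + int k)"
proof -
  have "\<bar>h u - h w\<bar> \<le> int k \<and> even (h u - h w + int k)"
    using assms(2)
  proof (induction k arbitrary: w)
    case (Suc k)
    then obtain x where x: "(u, x) \<in> adj A ^^ k" "(x, w) \<in> adj A" by auto
    have "h x = h w + 1 \<or> h x = h w - 1"
      using rankings_adj[OF assms(1) x(2)] by linarith
    then show ?case using Suc.IH[OF x(1)] by auto
  qed auto
  then show "\<bar>h u - h w\<bar> \<le> int k" "even (h u - h w + int k)" by auto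
qed

text \<open>The indicator function of the side \<open>Y\<close> is a ranking. It serves as a parity
  witness for distances.\<close>

lemma bipartite_imp_ranking:
  assumes "simple_graph A" "bipartite A"
  obtains h where "h \<in> rankings A"
proof -
  obtain X Y where XY: "X \<union> Y = verts A" "X \<inter> Y = {}"
    "\<forall>e\<in>edges A. \<exists>x\<in>X. \<exists>y\<in>Y. e = {x, y}"
    using assms(2) unfolding bipartite_def by auto
  define h where "h = (\<lambda>x\<in>verts A. if x \<in> X then 0 else 1 :: int)"
  have "\<bar>h u - h w\<bar> = 1" if uw: "(u, w) \<in> adj A" for u w
  proof -
    obtain x y where "x \<in> X" "y \<in> Y" "{u, w} = {x, y}"
      using XY(3) uw unfolding adj_def by blast
    then show ?thesis
      using XY(1,2) by (auto simp: doubleton_eq_iff h_def)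
  qed
  moreover have "h \<in> verts A \<rightarrow>\<^sub>E UNIV" unfolding h_def by auto
  ultimately have "h \<in> rankings A" unfolding rankings_def by auto
  then show thesis by (rule that)
qed


section \<open>Rankings and ideals of the elevation poset\<close>

definition ranking_class :: "'a colored_graph \<Rightarrow> ('a \<Rightarrow> int) \<Rightarrow> ('a \<Rightarrow> int) set" where
  "ranking_class A h = shift_rel A `` {h}"

text \<open>With h(w) - h(v) = 2k - D(w,v), the inequality says t <= k without a division.
  Subtracting h(v) makes the set independent of the representative.\<close>

definition marked :: "'a colored_graph \<Rightarrow> 'a \<Rightarrow> ('a \<Rightarrow> int) \<Rightarrow> ('a \<times> nat) set" where
  "marked A v h =
     {(w, t) \<in> elevation_elems A v. 2 * int t \<le> h w - h v + int (graph_dist A w v)}"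

text \<open>All representatives have the same marked set, so the union is that common set and no
  representative has to be chosen.\<close>

definition class_marked :: "'a colored_graph \<Rightarrow> 'a \<Rightarrow> ('a \<Rightarrow> int) set \<Rightarrow> ('a \<times> nat) set" where
  "class_marked A v B = (\<Union>h\<in>B. marked A v h)"

lemma ranking_classesE:
  assumes "B \<in> ranking_classes A"
  obtains h where "h \<in> rankings A" "B = ranking_class A h"
  using assms unfolding ranking_classes_def ranking_class_def by (auto elim: quotientE)

lemma ranking_class_in_classes: "h \<in> rankings A \<Longrightarrow> ranking_class A h \<in> ranking_classes A"
  unfolding ranking_classes_def ranking_class_def by (rule quotientI)

lemma ranking_class_eq: "(h, g) \<in> shift_rel A \<Longrightarrow> ranking_class A h = ranking_class A g"
  unfolding ranking_class_def by (rule equiv_class_eq[OF equiv_shift_rel])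

lemma ranking_class_self: "h \<in> rankings A \<Longrightarrow> h \<in> ranking_class A h"
  unfolding ranking_class_def by (rule equiv_class_self[OF equiv_shift_rel])

locale rooted_bipartite_graph =
  fixes A :: "'a colored_graph" and v :: 'a
  assumes fin: "finite (verts A)"
    and conn: "connected_graph A"
    and simple: "simple_graph A"
    and bip: "bipartite A"
    and v: "v \<in> verts A"
begin

section \<open>Distances to the root\<close>

abbreviation d :: "'a \<Rightarrow> nat" where "d w \<equiv> graph_dist A w v"

lemma path_to_v: "w \<in> verts A \<Longrightarrow> (w, v) \<in> adj A ^^ d w"
  using conn v relpow_graph_dist unfolding connected_graph_def by metis

lemma d_v: "d v = 0"
  using graph_dist_le[of v v 0 A] by simp

lemma d_pos: "w \<in> verts A \<Longrightarrow> w \<noteq> v \<Longrightarrow> 0 < d w"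
  using path_to_v[of w] by (cases "d w") auto

lemma d_le_Suc: "(u, w) \<in> adj A \<Longrightarrow> d u \<le> Suc (d w)"
  by (metis graph_dist_le relpow_Suc_I2 path_to_v adj_verts(2) simple)

lemma ranking_bound: "h \<in> rankings A \<Longrightarrow> w \<in> verts A \<Longrightarrow> \<bar>h w - h v\<bar> \<le> int (d w)"
  using rankings_relpow(1) path_to_v by metis

lemma ranking_parity: "h \<in> rankings A \<Longrightarrow> w \<in> verts A \<Longrightarrow> even (h w - h v + int (d w))"
  using rankings_relpow(2) path_to_v by metis

text \<open>For any ranking \<open>h\<close>, D(u,v) has the parity of h(u) - h(v). Since h(u) and
  h(w) differ by one, the distances have different parities; by the triangle inequality they differ
  by exactly one.\<close>

lemma d_adj:
  assumes "(u, w) \<in> adj A"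
  shows "d u + 1 = d w \<or> d w + 1 = d u"
proof -
  note uw = adj_verts[OF simple assms]
  obtain h where h: "h \<in> rankings A"
    using bipartite_imp_ranking[OF simple bip] .
  have "d u \<noteq> d w"
    using ranking_parity[OF h uw(1)] ranking_parity[OF h uw(2)] rankings_adj[OF h assms]
    by (auto simp: abs_if split: if_splits) presburger+
  then show ?thesis
    using d_le_Suc[OF assms] d_le_Suc[OF uw(4)] by linarith
qed

text \<open>Take the first step of a shortest walk from \<open>w\<close> to
  \<open>v\<close>.\<close>

lemma closer_neighbor:
  assumes "w \<in> verts A" "w \<noteq> v"
  obtains u where "(u, w) \<in> adj A" "d u + 1 = d w"
proof -
  obtain k where k: "d w = Suc k"
    using d_pos[OF assms] by (cases "d w") auto
  obtain u where u: "(w, u) \<in> adj A" "(u, v) \<in> adj A ^^ k"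
    using path_to_v[OF assms(1)] unfolding k by (meson relpow_Suc_E2)
  have "d u \<le> k" using graph_dist_le[OF u(2)] .
  with d_adj[OF u(1)] k have "d u + 1 = d w" by auto
  with adj_verts(4)[OF simple u(1)] show thesis by (rule that)
qed

subsection \<open>From rankings to ideals\<close>

text \<open>Treats both kinds of covers at once: 2t - D(w,v) is the normalised height at which (w,t)
  becomes marked, and this threshold grows by one along every cover.\<close>

lemma elevation_coversD:
  assumes "((w, s), (u, t)) \<in> elevation_covers A v"
  shows "(w, u) \<in> adj A \<or> (u, w) \<in> adj A"
    and "2 * int s - int (d w) + 1 = 2 * int t - int (d u)"
    and "(w, s) \<in> elevation_elems A v"
  using assms unfolding elevation_covers_def by auto

text \<open>Going down a cover lowers the threshold by one, while the ranking falls by at most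
  one.\<close>

lemma marked_down:
  assumes h: "h \<in> rankings A" and xy: "(x, y) \<in> elevation_covers A v" and y: "y \<in> marked A v h"
  shows "x \<in> marked A v h"
proof -
  obtain w s u t where wu: "x = (w, s)" "y = (u, t)" by fastforce
  note * = elevation_coversD[OF xy[unfolded wu]]
  then have "\<bar>h w - h u\<bar> = 1"
    using rankings_adj[OF h] by (metis abs_minus_commute)
  with * y show ?thesis unfolding marked_def wu by auto
qed

lemma marked_order_ideal:
  assumes h: "h \<in> rankings A"
  shows "order_ideal (elevation_poset A v) (marked A v h)"
proof -
  have "x \<in> marked A v h" if "(x, y) \<in> (elevation_covers A v)\<^sup>*" "y \<in> marked A v h" for x y
    using that by (induction rule: converse_rtrancl_induct) (auto intro: marked_down[OF h])
  then show ?thesis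
    unfolding order_ideal_def lless_def elevation_poset_def by (auto simp: marked_def)
qed

lemma marked_mono_iff:
  assumes h: "h \<in> rankings A" and g: "g \<in> rankings A"
  shows "marked A v h \<subseteq> marked A v g \<longleftrightarrow> (\<forall>w\<in>verts A. h w - h v \<le> g w - g v)"
proof
  assume sub: "marked A v h \<subseteq> marked A v g"
  show "\<forall>w\<in>verts A. h w - h v \<le> g w - g v"
  proof
    fix w assume w: "w \<in> verts A"
    obtain k where k: "h w - h v + int (d w) = 2 * k"
      using evenE[OF ranking_parity[OF h w]] .
    have bounds: "\<bar>h w - h v\<bar> \<le> int (d w)" "\<bar>g w - g v\<bar> \<le> int (d w)"
      using ranking_bound w h g by auto
    \<comment> \<open>If k <= 0, the normalised height of \<open>h\<close> at \<open>w\<close> is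
      already the least possible, -D(w,v). Otherwise (w,k) is the top marked element of the column
      of \<open>w\<close>, and finding it marked for \<open>g\<close> gives the inequality.\<close>
    show "h w - h v \<le> g w - g v"
    proof (cases "k \<le> 0")
      case False
      then have "w \<noteq> v" using k d_v by auto
      with False k bounds w have "(w, nat k) \<in> marked A v h"
        unfolding marked_def elevation_elems_def by auto
      with sub have "(w, nat k) \<in> marked A v g" by blast
      with False k show ?thesis unfolding marked_def by auto
    qed (use bounds k in auto)
  qed
qed (fastforce simp: marked_def elevation_elems_def)

lemma marked_eq_iff_shift:
  assumes h: "h \<in> rankings A" and g: "g \<in> rankings A"
  shows "marked A v h = marked A v g \<longleftrightarrow> (h, g) \<in> shift_rel A"
proof
  assume "marked A v h = marked A v g"
  then have "\<forall>w\<in>verts A. h w - h v \<le> g w - g v" "\<forall>w\<in>verts A. g w - g v \<le> h w - h v"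
    unfolding marked_mono_iff[OF h g, symmetric] marked_mono_iff[OF g h, symmetric] by simp_all
  then have "\<forall>w\<in>verts A. g w = h w + (g v - h v)" by force
  then show "(h, g) \<in> shift_rel A" using h g unfolding shift_rel_def by blast
next
  assume "(h, g) \<in> shift_rel A"
  then obtain c where "\<forall>w\<in>verts A. g w = h w + c" unfolding shift_rel_def by auto
  then show "marked A v h = marked A v g"
    using v unfolding marked_def elevation_elems_def by auto
qed

lemma class_marked_ranking_class:
  assumes h: "h \<in> rankings A"
  shows "class_marked A v (ranking_class A h) = marked A v h"
proof -
  have "marked A v g \<subseteq> marked A v h" if "g \<in> ranking_class A h" for g
    using that h marked_eq_iff_shift[OF h, of g]
    unfolding ranking_class_def by (auto simp: shift_rel_def)
  then show ?thesis
    using ranking_class_self[OF h] unfolding class_marked_def by blast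
qed

subsection \<open>From ideals to rankings\<close>

lemma ideal_down:
  assumes "order_ideal (elevation_poset A v) S" "y \<in> S" "(x, y) \<in> elevation_covers A v"
  shows "x \<in> S"
proof -
  obtain w s u t where wu: "x = (w, s)" "y = (u, t)" by fastforce
  \<comment> \<open>Ideals are defined by the strict order; \<open>x\<close> and \<open>y\<close>
    differ because their values of 2t - D(w,v) do.\<close>
  have "x \<noteq> y" "x \<in> elevation_elems A v"
    using elevation_coversD[OF assms(3)[unfolded wu]] unfolding wu by auto
  then have "x \<sqsubset>\<^bsub>elevation_poset A v\<^esub> y" "x \<in> carrier (elevation_poset A v)"
    using assms(3) unfolding lless_def elevation_poset_def by auto
  then show ?thesis using assms(1,2) unfolding order_ideal_def by blast
qed

text \<open>For a neighbor \<open>u\<close> of \<open>w\<close> closer to \<open>v\<close>, the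
  elements (w,t), (u,t), (w,t+1) form a chain of two covers, so an ideal containing (w,t+1) contains
  (w,t).\<close>

lemma ideal_column:
  assumes S: "order_ideal (elevation_poset A v) S"
  shows "{t. (w, t) \<in> S} = {1..card {t. (w, t) \<in> S}}"
proof (rule initial_segment_eq_atLeastAtMost)
  have elems: "S \<subseteq> elevation_elems A v"
    using S unfolding order_ideal_def elevation_poset_def by auto
  then show "{t. (w, t) \<in> S} \<subseteq> {1..d w}"
    unfolding elevation_elems_def by auto
  fix t :: nat assume t: "1 \<le> t" "Suc t \<in> {t. (w, t) \<in> S}"
  then have w: "w \<in> verts A" "w \<noteq> v" "Suc t \<le> d w"
    using elems unfolding elevation_elems_def by auto
  obtain u where u: "(u, w) \<in> adj A" "d u + 1 = d w"
    using closer_neighbor[OF w(1,2)] .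
  \<comment> \<open>D(u,v) = D(w,v) - 1 >= t >= 1, so (u,t) really is an element.\<close>
  have uv: "u \<in> verts A" "u \<noteq> v"
    using adj_verts(1)[OF simple u(1)] u(2) t(1) w(3) d_v by auto
  have "((w, t), (u, t)) \<in> elevation_covers A v" "((u, t), (w, Suc t)) \<in> elevation_covers A v"
    using u uv w t(1) unfolding elevation_covers_def elevation_elems_def by auto
  then show "t \<in> {t. (w, t) \<in> S}"
    using t(2) ideal_down[OF S] by blast
qed

text \<open>The column heights k(w) of the ideal determine the ranking 2k(w) - D(w,v). The two kinds
  of covers bound the change of \<open>k\<close> along an edge from the two sides.\<close>

lemma ideal_eq_marked:
  assumes S: "order_ideal (elevation_poset A v) S"
  obtains h where "h \<in> rankings A" "marked A v h = S"
proof -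
  define k where "k w = card {t. (w, t) \<in> S}" for w
  have elems: "S \<subseteq> elevation_elems A v"
    using S unfolding order_ideal_def elevation_poset_def by auto
  have mem: "(w, t) \<in> S \<longleftrightarrow> 1 \<le> t \<and> t \<le> k w" for w t
    using ideal_column[OF S, of w] unfolding k_def by auto
  \<comment> \<open>The top element of a nonempty column belongs to the elevation poset.\<close>
  have kd: "k w \<le> d w" for w
    using mem[of w "k w"] elems unfolding elevation_elems_def by (cases "k w") auto
  define h where "h = (\<lambda>w\<in>verts A. 2 * int (k w) - int (d w))"
  have h_v: "h v = 0" using v kd[of v] d_v unfolding h_def by simp
  have close: "\<bar>h u - h w\<bar> = 1" if uw: "(u, w) \<in> adj A" "d u + 1 = d w" for u w
  proof -
    note V = adj_verts[OF simple uw(1)]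
    have "w \<noteq> v" using uw(2) d_v by auto
    \<comment> \<open>Covers of the first kind: (w,t) lies below (u,t), applied to the top t =
      k(u).\<close>
    have "k u \<le> k w"
    proof (cases "k u")
      case (Suc j)
      then have "(u, k u) \<in> S" using mem by simp
      moreover have "((w, k u), (u, k u)) \<in> elevation_covers A v"
        using calculation elems uw V \<open>w \<noteq> v\<close> unfolding elevation_covers_def elevation_elems_def
        by auto
      ultimately have "(w, k u) \<in> S" by (rule ideal_down[OF S])
      then show ?thesis using mem by simp
    qed simp
    \<comment> \<open>Covers of the second kind: (u,j) lies below (w,j+1). For j >= 1 the distance
      D(w,v) >= k(w) >= 2 forces \<open>u\<close> to differ from \<open>v\<close>.\<close>
    moreover have "k w \<le> k u + 1"
    proof (cases "k w \<le> 1")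
      case False
      then obtain j where j: "k w = j + 1" "1 \<le> j"
        by (cases "k w") auto
      have "u \<noteq> v" using uw(2) kd[of w] j d_v by auto
      have "(w, j + 1) \<in> S" using mem j by simp
      moreover have "((u, j), (w, j + 1)) \<in> elevation_covers A v"
        using kd[of w] j uw V \<open>w \<noteq> v\<close> \<open>u \<noteq> v\<close>
        unfolding elevation_covers_def elevation_elems_def by auto
      ultimately have "(u, j) \<in> S" by (rule ideal_down[OF S])
      then show ?thesis using mem j by simp
    qed simp
    \<comment> \<open>As D(w,v) = D(u,v) + 1, the difference h(w) - h(u) is 2(k(w) - k(u)) - 1,
      hence -1 or 1.\<close>
    ultimately consider "k w = k u" | "k w = k u + 1" by linarith
    then show ?thesis using V(1,2) by cases (simp_all add: h_def flip: uw(2))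
  qed
  have "\<bar>h u - h w\<bar> = 1" if "(u, w) \<in> adj A" for u w
    using d_adj[OF that] close that adj_verts(4)[OF simple that] by (metis abs_minus_commute)
  moreover have "h \<in> verts A \<rightarrow>\<^sub>E UNIV" unfolding h_def by auto
  ultimately have "h \<in> rankings A" unfolding rankings_def by auto
  moreover have "marked A v h = S"
    using elems mem unfolding marked_def h_v by (auto simp: h_def elevation_elems_def)
  ultimately show thesis by (rule that)
qed

subsection \<open>Raisings\<close>

lemma class_marked_raising_step:
  assumes "(B, C) \<in> raising_step A v"
  shows "C \<in> ranking_classes A" "class_marked A v B \<subseteq> class_marked A v C"
proof -
  obtain h w where B: "B \<in> ranking_classes A" "h \<in> B"
    and w: "w \<in> verts A" "w \<noteq> v" "is_source A h w" and C: "C = ranking_class A (raise w h)"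
    using assms unfolding raising_step_def ranking_class_def by auto
  obtain g where g: "B = ranking_class A g"
    using B(1) by (rule ranking_classesE)
  have gh: "(g, h) \<in> shift_rel A"
    using B(2) unfolding g ranking_class_def by simp
  then have h: "h \<in> rankings A" unfolding shift_rel_def by auto
  have rh: "raise w h \<in> rankings A"
    using raise_rankings[OF simple h w(1,3)] .
  show "C \<in> ranking_classes A"
    unfolding C by (rule ranking_class_in_classes[OF rh])
  \<comment> \<open>Because \<open>w\<close> is not \<open>v\<close>, the base value h(v) stays
    fixed and no normalised height decreases.\<close>
  have "marked A v h \<subseteq> marked A v (raise w h)"
    unfolding marked_mono_iff[OF h rh] using w(2) by (simp add: raise_def)
  then show "class_marked A v B \<subseteq> class_marked A v C"
    unfolding g ranking_class_eq[OF gh] C class_marked_ranking_class[OF h]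
      class_marked_ranking_class[OF rh] .
qed

lemma class_marked_raisings:
  assumes "(B, C) \<in> (raising_step A v)\<^sup>*"
  shows "class_marked A v B \<subseteq> class_marked A v C"
  using assms by (induction rule: rtrancl_induct) (use class_marked_raising_step in blast)+

text \<open>Supplies the next raising on the way from \<open>h\<close> up to \<open>g\<close>; the
  gap of two ensures that the raised ranking is still below \<open>g\<close>.\<close>

lemma source_below:
  assumes h: "h \<in> rankings A" and g: "g \<in> rankings A" and "h v = g v"
    and le: "\<And>w. w \<in> verts A \<Longrightarrow> h w \<le> g w"
    and u: "u \<in> verts A" "h u \<noteq> g u"
  obtains w where "w \<in> verts A" "w \<noteq> v" "is_source A h w" "h w + 2 \<le> g w"
proof -
  define U where "U = {w \<in> verts A. h w \<noteq> g w}"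
  have "finite U" "U \<noteq> {}" using fin u unfolding U_def by auto
  then obtain w where w: "w \<in> U" and min: "\<And>x. x \<in> U \<Longrightarrow> h w \<le> h x"
    using arg_min_if_finite[of U h] arg_min_least[of U _ h] by metis
  have wV: "w \<in> verts A" "h w \<noteq> g w" using w unfolding U_def by auto
  \<comment> \<open>Rankings that agree at \<open>v\<close> have equal parity at every vertex, so
    distinct values differ by at least two.\<close>
  have "even (g w - h w)"
    using ranking_parity[OF h wV(1)] ranking_parity[OF g wV(1)] \<open>h v = g v\<close> by presburger
  then have gap: "h w + 2 \<le> g w"
    using le[OF wV(1)] wV(2) by presburger
  have "h w < h x" if wx: "(w, x) \<in> adj A" for x
  proof (rule ccontr)
    assume "\<not> h w < h x"
    \<comment> \<open>A lower neighbor \<open>x\<close> lies outside \<open>U\<close> by minimality,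
      so g(x) = h(x) = h(w) - 1. Then \<open>g\<close> would jump by at least three along the
      edge.\<close>
    then have hx: "h x = h w - 1" using rankings_adj[OF h wx] by auto
    then have "x \<notin> U" using min by force
    then have "g x = h x" using adj_verts(2)[OF simple wx] unfolding U_def by simp
    then show False using rankings_adj[OF g wx] hx gap by auto
  qed
  then have "is_source A h w" unfolding is_source_def by blast
  moreover have "w \<noteq> v" using gap \<open>h v = g v\<close> by auto
  ultimately show thesis using that wV(1) gap by blast
qed

text \<open>Induction on the total gap between \<open>g\<close> and \<open>h\<close>: raising at the
  vertex from \<open>source_below\<close> reduces it and keeps the ranking below
  \<open>g\<close>.\<close>

lemma raisings_if_le:
  assumes "h \<in> rankings A" "g \<in> rankings A" "h v = g v"
    and "\<And>w. w \<in> verts A \<Longrightarrow> h w \<le> g w"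
  shows "(ranking_class A h, ranking_class A g) \<in> (raising_step A v)\<^sup>*"
  using assms
proof (induction "nat (\<Sum>w\<in>verts A. g w - h w)" arbitrary: h rule: less_induct)
  case less
  show ?case
  proof (cases "\<exists>u\<in>verts A. h u \<noteq> g u")
    case False
    then have "h = g"
      using less.prems(1,2) unfolding rankings_def by (auto intro: PiE_ext)
    then show ?thesis by simp
  next
    case True
    then obtain w where w: "w \<in> verts A" "w \<noteq> v" "is_source A h w" "h w + 2 \<le> g w"
      using source_below[OF less.prems] by blast
    have rh: "raise w h \<in> rankings A"
      using raise_rankings[OF simple less.prems(1) w(1,3)] .
    have le: "raise w h x \<le> g x" if "x \<in> verts A" for x
      using less.prems(4)[OF that] w(4) unfolding raise_def by simp
    have "(\<Sum>x\<in>verts A. g x - raise w h x) < (\<Sum>x\<in>verts A. g x - h x)"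
      using fin w(1) by (intro sum_strict_mono_ex1) (auto simp: raise_def)
    \<comment> \<open>Needed because the measure is truncated by \<open>nat\<close>, which hides a
      decrease among negative integers.\<close>
    moreover have "0 \<le> (\<Sum>x\<in>verts A. g x - raise w h x)"
      using le by (intro sum_nonneg) simp
    ultimately have "(ranking_class A (raise w h), ranking_class A g) \<in> (raising_step A v)\<^sup>*"
      using less.prems(3) w(2) by (intro less.hyps rh less.prems(2) le) (auto simp: raise_def)
    moreover have "(ranking_class A h, ranking_class A (raise w h)) \<in> raising_step A v"
      using w ranking_class_in_classes[OF less.prems(1)] ranking_class_self[OF less.prems(1)]
      unfolding raising_step_def ranking_class_def by blast
    ultimately show ?thesis by simp
  qed
qed

lemma raisings_if_marked_subset:
  assumes h: "h \<in> rankings A" and g: "g \<in> rankings A" and sub: "marked A v h \<subseteq> marked A v g"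
  shows "(ranking_class A h, ranking_class A g) \<in> (raising_step A v)\<^sup>*"
proof -
  \<comment> \<open>The representative of the class of \<open>g\<close> that agrees with
    \<open>h\<close> at \<open>v\<close>.\<close>
  define g' where "g' = (\<lambda>w\<in>verts A. g w + (h v - g v))"
  have g': "g' \<in> rankings A"
    using g adj_verts(1,2)[OF simple] unfolding rankings_def g'_def by auto
  moreover have "(g, g') \<in> shift_rel A"
    using g g' unfolding shift_rel_def g'_def by auto
  moreover have "(ranking_class A h, ranking_class A g') \<in> (raising_step A v)\<^sup>*"
    using sub v unfolding marked_mono_iff[OF h g]
    by (intro raisings_if_le h g') (auto simp: g'_def algebra_simps)
  ultimately show ?thesis using ranking_class_eq by metis
qed

subsection \<open>The isomorphism\<close>

lemma raisings_iff:
  assumes "B \<in> ranking_classes A" "C \<in> ranking_classes A"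
  shows "(B, C) \<in> (raising_step A v)\<^sup>* \<longleftrightarrow> class_marked A v B \<subseteq> class_marked A v C"
  using assms class_marked_raisings raisings_if_marked_subset
  by (metis class_marked_ranking_class ranking_classesE)

lemma bij_betw_class_marked:
  "bij_betw (class_marked A v) (ranking_classes A) {S. order_ideal (elevation_poset A v) S}"
proof (rule bij_betw_imageI[OF inj_onI equalityI[OF subsetI subsetI]])
  fix B C
  assume "B \<in> ranking_classes A" "C \<in> ranking_classes A" "class_marked A v B = class_marked A v C"
  then show "B = C"
    by (metis class_marked_ranking_class ranking_classesE marked_eq_iff_shift ranking_class_eq)
next
  fix S assume "S \<in> class_marked A v ` ranking_classes A"
  then show "S \<in> {S. order_ideal (elevation_poset A v) S}"
    by (auto elim!: ranking_classesE simp: class_marked_ranking_class marked_order_ideal)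
next
  fix S assume "S \<in> {S. order_ideal (elevation_poset A v) S}"
  then obtain h where "h \<in> rankings A" "marked A v h = S"
    using ideal_eq_marked by blast
  then show "S \<in> class_marked A v ` ranking_classes A"
    using class_marked_ranking_class ranking_class_in_classes by (metis imageI)
qed

text \<open>Antisymmetry is the point: raisings in both directions give equal ideals, and the ideal
  determines the class.\<close>

lemma partial_order_ranking_poset: "partial_order (ranking_poset A v)"
proof -
  have "B = C" if "(B, C) \<in> (raising_step A v)\<^sup>*" "(C, B) \<in> (raising_step A v)\<^sup>*"
    "B \<in> ranking_classes A" "C \<in> ranking_classes A" for B C
    using that class_marked_raisings bij_betw_class_marked
    by (metis bij_betw_def inj_on_eq_iff subset_antisym)
  then show ?thesis
    unfolding ranking_poset_def by unfold_locales auto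
qed

lemma poset_isomorphic_ideal_poset:
  "poset_isomorphic (ranking_poset A v) (ideal_poset (elevation_poset A v))"
proof -
  have "order_emb (ranking_poset A v) (ideal_poset (elevation_poset A v)) (class_marked A v)"
    using partial_order_ranking_poset partial_order_ideal_poset
    unfolding order_emb_def partial_order_def
    by (auto simp: ranking_poset_def ideal_poset_def raisings_iff)
  then show ?thesis
    using partial_order_ranking_poset partial_order_ideal_poset bij_betw_class_marked
    unfolding poset_isomorphic_def
    by (auto simp: ranking_poset_def ideal_poset_def)
qed

section \<open>Finiteness and distributivity\<close>

lemma finite_ranking_classes: "finite (ranking_classes A)"
proof -
  have "elevation_elems A v \<subseteq> Sigma (verts A) (\<lambda>w. {1..d w})"
    unfolding elevation_elems_def by auto
  then have "finite (elevation_elems A v)"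
    using fin by (auto intro: finite_subset)
  moreover have "{S. order_ideal (elevation_poset A v) S} \<subseteq> Pow (elevation_elems A v)"
    unfolding order_ideal_def elevation_poset_def by auto
  ultimately show ?thesis
    using bij_betw_finite[OF bij_betw_class_marked] by (metis finite_Pow_iff finite_subset)
qed

lemma distributive_lattice_ranking_poset: "distributive_lattice (ranking_poset A v)"
  by (rule distributive_lattice_if_ring_of_sets[OF partial_order_ranking_poset,
        where f = "class_marked A v" and F = "{S. order_ideal (elevation_poset A v) S}"])
    (auto simp: ranking_poset_def bij_betw_class_marked raisings_iff
      intro: order_ideal_Un order_ideal_Int)

end

theorem mainTheorem4:
  fixes A :: "'a colored_graph" and n :: nat and v :: 'a
  assumes "chromotopology n A" and "v \<in> verts A"
  shows "poset_isomorphic (ranking_poset A v) (ideal_poset (elevation_poset A v)) \<and>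
    finite (carrier (ranking_poset A v)) \<and> distributive_lattice (ranking_poset A v)"
proof -
  interpret rooted_bipartite_graph A v
    using assms unfolding chromotopology_def by unfold_locales auto
  show ?thesis
    using poset_isomorphic_ideal_poset finite_ranking_classes distributive_lattice_ranking_poset
    by (simp add: ranking_poset_def)
qed

end
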